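(* Let $\kappa$ be an infinite cardinal. (a) If $\kappa$ is exponential, then $\mathbf{Min}(\kappa,\sigma)$ holds for every cardinal $\sigma$ with $\kappa=2^\sigma$. (b) If $\kappa$ is non-exponential, then for every infinite cardinal $\sigma$, $\mathbf{Min}(\kappa,\sigma)$ holds if and only if $\sigma=\log\kappa$ and $\mathrm{cf}(\log\kappa)=\omega$.
   Context: For infinite cardinals $\kappa,\sigma$, $\mathbf{Min}(\kappa,\sigma)$ denotes the statement: there exists a sequence of cardinals $\{\sigma_n:n\in\mathbb N\}$ (finite values allowed) with $\sigma=\sup_{n\in\mathbb N}\sigma_n$ and $\sup_{n\in\mathbb N} 2^{\sigma_n}\le\kappa\le 2^\sigma$. A cardinal $\kappa$ is exponential if $\kappa=2^\sigma$ for some cardinal $\sigma$, and non-exponential otherwise. For infinite $\kappa$, $\log\kappa=\min\{\sigma:\kappa\le 2^\sigma\}$. $\mathrm{cf}$ denotes cofinality. *)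

theory Defs
  imports Main
begin

unbundle cardinal_syntax

(* A cardinal is a relation r with Card_order r; equality of cardinals is =o and their
   order is \<le>o, both of which compare relations over different types. *)

lemma cardinal_transfer:
  fixes r :: "'a rel" and s :: "'b rel"
  assumes "Card_order r" and "r \<le>o s"
  shows "\<exists>t :: 'b rel. Card_order t \<and> t =o r"
proof -
  have eq: "|Field r| =o r" using assms(1) by (rule card_of_Field_ordIso)
  then have "|Field r| \<le>o s" using assms(2) by (rule ordIso_ordLeq_trans)
  then obtain B where "|Field r| =o |B :: 'b set|"
    using internalize_card_of_ordLeq[of "Field r" s] by blast
  then have "|B| =o r" using eq ordIso_symmetric ordIso_transitive by blast
  then show ?thesis using card_of_Card_order by blast
qed

lemma Card_order_ordLeq_UNIV:
  fixes r :: "'a rel"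
  assumes "Card_order r"
  shows "r \<le>o |UNIV :: 'a set|"
  using card_of_Field_ordIso[OF assms] card_of_mono1[OF subset_UNIV]
    ordIso_ordLeq_trans ordIso_symmetric by blast

section \<open>Suprema of sequences\<close>

(* The competing upper bounds t range over the type of the sequence only; by is_csup_least
   the supremum lies below upper bounds of every type. *)
definition is_csup :: "(nat \<Rightarrow> 'a rel) \<Rightarrow> 'a rel \<Rightarrow> bool" where
  "is_csup s r \<longleftrightarrow> Card_order r \<and> (\<forall>n. s n \<le>o r) \<and>
     (\<forall>t :: 'a rel. Card_order t \<and> (\<forall>n. s n \<le>o t) \<longrightarrow> r \<le>o t)"

definition csup :: "(nat \<Rightarrow> 'a rel) \<Rightarrow> 'a rel" where
  "csup s = (SOME r. is_csup s r)"

lemma is_csup_csup: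
  fixes s :: "nat \<Rightarrow> 'a rel"
  assumes "\<And>n. Card_order (s n)"
  shows "is_csup s (csup s)"
proof -
  let ?R = "{r :: 'a rel. Card_order r \<and> (\<forall>n. s n \<le>o r)}"
  have "|UNIV :: 'a set| \<in> ?R"
    using Card_order_ordLeq_UNIV[OF assms] card_of_Card_order by blast
  then have "\<exists>r\<in>?R. \<forall>r'\<in>?R. r \<le>o r'"
    using exists_minim_Card_order[of ?R] by blast
  then have "\<exists>r. is_csup s r" unfolding is_csup_def by blast
  then show ?thesis unfolding csup_def by (rule someI_ex)
qed

lemma is_csup_least:
  fixes s :: "nat \<Rightarrow> 'a rel" and t :: "'b rel"
  assumes "is_csup s r" and "Card_order t" and ub: "\<And>n. s n \<le>o t"
  shows "r \<le>o t"
proof (cases "t \<le>o r")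
  case True
  then obtain u :: "'a rel" where u: "Card_order u" "u =o t"
    using cardinal_transfer[OF assms(2)] by blast
  have "s n \<le>o u" for n
    using ub[of n] ordIso_symmetric[OF u(2)] by (rule ordLeq_ordIso_trans)
  then have "r \<le>o u" using assms(1) u(1) unfolding is_csup_def by blast
  then show ?thesis using u(2) by (rule ordLeq_ordIso_trans)
next
  case False
  have "Well_order r" "Well_order t"
    using assms unfolding is_csup_def by (auto simp: card_order_on_well_order_on)
  then show ?thesis using False ordLeq_total by blast
qed

section \<open>Exponential cardinals, logarithm and cofinality\<close>

(* Restricting c to the type of k loses nothing, since 2 ^ c = k implies c < k:
   see exponentialI. *)
definition exponential :: "'a rel \<Rightarrow> bool" where
  "exponential k \<longleftrightarrow> (\<exists>c :: 'a rel. Card_order c \<and> k =o ctwo ^c c)"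

lemma exponentialI:
  fixes k :: "'a rel" and c :: "'b rel"
  assumes "Card_order c" and eq: "k =o ctwo ^c c"
  shows "exponential k"
proof -
  have "c \<le>o ctwo ^c c" using ordLess_ctwo_cexp[OF assms(1)] by (rule ordLess_imp_ordLeq)
  then have "c \<le>o k" using ordIso_symmetric[OF eq] by (rule ordLeq_ordIso_trans)
  then obtain d :: "'a rel" where d: "Card_order d" "d =o c"
    using cardinal_transfer[OF assms(1)] by blast
  have "ctwo ^c d =o ctwo ^c c"
    using d(2) Card_order_ctwo assms(1) d(1) cexp_cong2 ordIso_symmetric by blast
  then show ?thesis
    unfolding exponential_def using d(1) eq ordIso_symmetric ordIso_transitive by blast
qed

(* The minimum is attained at some c \<le> k, so c may again range over the type of k;
   by is_clog_least the result is least among exponents of every type. *)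
definition is_clog :: "'a rel \<Rightarrow> 'a rel \<Rightarrow> bool" where
  "is_clog k c \<longleftrightarrow> Card_order c \<and> k \<le>o ctwo ^c c \<and>
     (\<forall>d :: 'a rel. Card_order d \<and> k \<le>o ctwo ^c d \<longrightarrow> c \<le>o d)"

definition clog :: "'a rel \<Rightarrow> 'a rel" where
  "clog k = (SOME c. is_clog k c)"

lemma is_clog_clog:
  fixes k :: "'a rel"
  assumes "Card_order k"
  shows "is_clog k (clog k)"
proof -
  let ?R = "{c :: 'a rel. Card_order c \<and> k \<le>o ctwo ^c c}"
  have "k \<in> ?R" using assms ordLess_imp_ordLeq[OF ordLess_ctwo_cexp[OF assms]] by blast
  then have "\<exists>c\<in>?R. \<forall>d\<in>?R. c \<le>o d" using exists_minim_Card_order[of ?R] by blast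
  then have "\<exists>c. is_clog k c" unfolding is_clog_def by blast
  then show ?thesis unfolding clog_def by (rule someI_ex)
qed

lemma is_clog_least:
  fixes k c :: "'a rel" and d :: "'b rel"
  assumes "is_clog k c" and "Card_order d" and le: "k \<le>o ctwo ^c d"
  shows "c \<le>o d"
proof (cases "d \<le>o c")
  case True
  then obtain e :: "'a rel" where e: "Card_order e" "e =o d"
    using cardinal_transfer[OF assms(2)] by blast
  have "ctwo ^c d =o ctwo ^c e"
    using e Card_order_ctwo assms(2) cexp_cong2 ordIso_symmetric by blast
  then have "k \<le>o ctwo ^c e" using le ordLeq_ordIso_trans by blast
  then have "c \<le>o e" using assms(1) e(1) unfolding is_clog_def by blast
  then show ?thesis using e(2) by (rule ordLeq_ordIso_trans)
next
  case False
  have "Well_order c" "Well_order d"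
    using assms unfolding is_clog_def by (auto simp: card_order_on_well_order_on)
  then show ?thesis using False ordLeq_total by blast
qed

(* The library's cofinal A r asks for strictly larger elements of A. For an infinite cardinal
   r, which has no last element, this is the usual notion, and only such r are intended. *)
definition is_cf :: "'a rel \<Rightarrow> 'a rel \<Rightarrow> bool" where
  "is_cf r c \<longleftrightarrow>
     (\<exists>A \<subseteq> Field r. cofinal A r \<and> c = |A| ) \<and>
     (\<forall>B \<subseteq> Field r. cofinal B r \<longrightarrow> c \<le>o |B| )"

definition cf :: "'a rel \<Rightarrow> 'a rel" where
  "cf r = (SOME c. is_cf r c)"

lemma is_cf_cf:
  fixes r :: "'a rel"
  assumes "Cinfinite r"
  shows "is_cf r (cf r)"
proof -
  let ?R = "{c. \<exists>A \<subseteq> Field r. cofinal A r \<and> c = |A| }"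
  have "cofinal (Field r) r"
    unfolding cofinal_def using assms infinite_Card_order_limit[of r]
    by (auto simp: cinfinite_def)
  then have "|Field r| \<in> ?R" by blast
  moreover have "\<forall>c\<in>?R. Card_order c" using card_of_Card_order by blast
  ultimately have "\<exists>c\<in>?R. \<forall>d\<in>?R. c \<le>o d" using exists_minim_Card_order[of ?R] by blast
  then have "\<exists>c. is_cf r c" unfolding is_cf_def by blast
  then show ?thesis unfolding cf_def by (rule someI_ex)
qed

section \<open>The relation Min\<close>

(* Meant for infinite cardinals k and c. The s n lie below their supremum c, so it is no
   restriction to take them over the type of c. *)
definition Min_card :: "'a rel \<Rightarrow> 'b rel \<Rightarrow> bool" where
  "Min_card k c \<longleftrightarrow>
     (\<exists>s :: nat \<Rightarrow> 'b rel. (\<forall>n. Card_order (s n)) \<and> c =o csup s \<and>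
        csup (\<lambda>n. ctwo ^c s n) \<le>o k \<and> k \<le>o ctwo ^c c)"

end

theory Submission
  imports Defs
begin

text \<open>
  Everything rests on two facts. First, \<open>clog \<kappa>\<close> is adjoint to exponentiation:
  \<open>clog \<kappa> \<le>o d\<close> iff \<open>\<kappa> \<le>o ctwo ^c d\<close> (\<open>clog_ordLeq_iff\<close>). Second, an infinite cardinal has
  cofinality \<open>\<omega>\<close> iff it is the supremum of a sequence of strictly smaller cardinals
  (\<open>cf_natLeq_if_csup\<close>, \<open>csup_if_cf_natLeq\<close>).

  If \<open>\<kappa>\<close> is exponential, the constant sequence with value \<open>\<sigma>\<close> witnesses \<open>Min_card \<kappa> \<sigma>\<close>.
  If it is not, then the condition \<open>2 ^ s n \<le> \<kappa>\<close> can never be an equality, so it says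
  \<open>2 ^ s n < \<kappa>\<close>, which by adjointness is \<open>s n < log \<kappa>\<close>, whereas \<open>\<kappa> \<le> 2 ^ \<sigma>\<close> says \<open>log \<kappa> \<le> \<sigma>\<close>.
  Hence \<open>Min_card \<kappa> \<sigma>\<close> asserts that \<open>\<sigma>\<close>, a supremum of cardinals below \<open>log \<kappa>\<close>, is at least
  \<open>log \<kappa>\<close>; that is, \<open>\<sigma> = log \<kappa>\<close> is the supremum of a sequence of smaller cardinals.
\<close>

section \<open>Suprema and logarithms\<close>

lemma Card_order_not_ordLeq_iff:
  assumes "Card_order r" and "Card_order t"
  shows "\<not> r \<le>o t \<longleftrightarrow> t <o r"
  using assms by (intro not_ordLeq_iff_ordLess) (simp_all add: card_order_on_well_order_on)

lemma ctwo_cexp_mono: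
  assumes "d \<le>o e"
  shows "ctwo ^c d \<le>o ctwo ^c e"
proof (cases "Field d = {}")
  case True
  \<comment> \<open>Here \<open>2 ^ 0 = 1\<close>, for which \<open>cexp_mono2'\<close> would demand that \<open>e\<close> be empty too.\<close>
  then show ?thesis
    by (auto simp: cexp_def ctwo_def Func_empty Field_card_of Func_is_emp intro!: card_of_singl_ordLeq)
next
  case False
  then show ?thesis using assms Card_order_ctwo by (intro cexp_mono2') auto
qed

lemma Card_order_csup:
  assumes "\<And>n. Card_order (s n)"
  shows "Card_order (csup s)"
  using is_csup_csup[of s, OF assms] by (simp add: is_csup_def)

lemma csup_upper:
  assumes "\<And>n. Card_order (s n)"
  shows "s n \<le>o csup s"
  using is_csup_csup[of s, OF assms] by (simp add: is_csup_def)

lemma csup_least: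
  assumes "\<And>n. Card_order (s n)" and "Card_order t" and "\<And>n. s n \<le>o t"
  shows "csup s \<le>o t"
  using is_csup_csup[of s, OF assms(1)] assms(2,3) by (rule is_csup_least)

lemma csup_const:
  assumes "Card_order r"
  shows "r =o csup (\<lambda>n. r)"
  unfolding ordIso_iff_ordLeq
  using csup_upper[of "\<lambda>n. r"] csup_least[of "\<lambda>n. r" r] assms ordLeq_refl[OF assms] by auto

lemma Card_order_clog:
  assumes "Card_order k"
  shows "Card_order (clog k)"
  using is_clog_clog[OF assms] unfolding is_clog_def by blast

lemma clog_ordLeq_iff:
  assumes "Card_order k" and "Card_order d"
  shows "clog k \<le>o d \<longleftrightarrow> k \<le>o ctwo ^c d"
proof
  assume "clog k \<le>o d"
  then have "ctwo ^c clog k \<le>o ctwo ^c d" by (rule ctwo_cexp_mono)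
  moreover have "k \<le>o ctwo ^c clog k"
    using is_clog_clog[OF assms(1)] unfolding is_clog_def by blast
  ultimately show "k \<le>o ctwo ^c d" using ordLeq_transitive by blast
next
  assume "k \<le>o ctwo ^c d"
  with is_clog_clog[OF assms(1)] assms(2) show "clog k \<le>o d" by (rule is_clog_least)
qed

lemma ordLess_clog_iff:
  assumes "Card_order k" and "Card_order d"
  shows "d <o clog k \<longleftrightarrow> ctwo ^c d <o k"
  unfolding Card_order_not_ordLeq_iff[OF Card_order_clog[OF assms(1)] assms(2), symmetric]
    Card_order_not_ordLeq_iff[OF assms(1) Card_order_cexp, symmetric] clog_ordLeq_iff[OF assms] ..

section \<open>Countable cofinality\<close>

text \<open>
  A nonempty finite set has a largest element, and none of its elements lies strictly above that.
  This bounds the cofinality from below by \<open>\<omega>\<close>.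
\<close>

lemma infinite_if_cofinal:
  assumes r: "Cinfinite r" and B: "B \<subseteq> Field r" "cofinal B r"
  shows "infinite B"
proof
  assume fin: "finite B"
  have wo: "wo_rel r"
    using r by (simp add: wo_rel_def card_order_on_well_order_on)
  have "Field r \<noteq> {}" using r by (auto simp: cinfinite_def)
  then have "B \<noteq> {}" using B(2) unfolding cofinal_def by blast
  from fin this B(1) have "\<exists>m\<in>B. \<forall>b\<in>B. (b, m) \<in> r"
  proof (induction B rule: finite_ne_induct)
    case (singleton x)
    then show ?case using wo_rel.TOTALS[OF wo] by blast
  next
    case (insert x F)
    then obtain m where m: "m \<in> F" "\<forall>b\<in>F. (b, m) \<in> r" by auto
    have "x \<in> Field r" "m \<in> Field r" using insert.prems m(1) by auto
    then have "(x, x) \<in> r" "(x, m) \<in> r \<or> (m, x) \<in> r"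
      using wo_rel.TOTALS[OF wo] by blast+
    then show ?case using m transD[OF wo_rel.TRANS[OF wo]] by blast
  qed
  then obtain m where m: "m \<in> B" "\<forall>b\<in>B. (b, m) \<in> r" by blast
  then obtain b where "b \<in> B" "m \<noteq> b" "(m, b) \<in> r"
    using B unfolding cofinal_def by blast
  then show False using m(2) antisymD[OF wo_rel.ANTISYM[OF wo]] by blast
qed

lemma ordLess_ordIso_underS:
  assumes t: "Card_order t" and r: "Card_order r" and less: "t <o r"
  shows "\<exists>a\<in>Field r. t =o |underS r a|"
proof -
  have wo: "Well_order r" "Well_order t"
    using r t by (simp_all add: card_order_on_well_order_on)
  obtain a where a: "a \<in> Field r" "t =o Restr r (underS r a)"
    using less ordLess_iff_ordIso_Restr[OF wo] by blast
  have "Field (Restr r (underS r a)) = underS r a"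
    using wo(1) by (simp add: Field_Restr_ofilter wo_rel.underS_ofilter wo_rel_def)
  then have "|Field t| =o |underS r a|" using card_of_cong[OF a(2)] by simp
  with ordIso_symmetric[OF card_of_Field_ordIso[OF t]] have "t =o |underS r a|"
    by (rule ordIso_transitive)
  then show ?thesis using a(1) by blast
qed

text \<open>
  A cardinal below \<open>r\<close> is the size of an initial segment of \<open>r\<close>. The points cutting off the
  segments of sizes \<open>s n\<close> are cofinal: a point \<open>b\<close> above all of them would make
  \<open>|underS r b| <o r\<close> an upper bound of the sequence.
\<close>

lemma cf_natLeq_if_csup:
  fixes r :: "'a rel" and s :: "nat \<Rightarrow> 'b rel"
  assumes r: "Cinfinite r" and s: "\<And>n. Card_order (s n)" and less: "\<And>n. s n <o r"
    and sup: "r \<le>o csup s"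
  shows "cf r =o natLeq"
proof -
  have Cr: "Card_order r" and wo: "wo_rel r"
    using r by (simp_all add: wo_rel_def card_order_on_well_order_on)
  have "\<exists>a\<in>Field r. s n =o |underS r a|" for n
    using s Cr less by (rule ordLess_ordIso_underS)
  then obtain a where a: "\<And>n. a n \<in> Field r" "\<And>n. s n =o |underS r (a n)|"
    by metis
  have cofin: "cofinal (range a) r"
  proof (rule ccontr)
    assume "\<not> cofinal (range a) r"
    then obtain b where b: "b \<in> Field r" "\<And>n. b = a n \<or> (b, a n) \<notin> r"
      unfolding cofinal_def by blast
    have "(a n, b) \<in> r" for n
      using b(1) b(2)[of n] a(1)[of n] wo_rel.TOTALS[OF wo] by blast
    then have "underS r (a n) \<subseteq> underS r b" for n
      by (rule underS_incr[OF wo_rel.TRANS[OF wo] wo_rel.ANTISYM[OF wo]])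
    then have "s n \<le>o |underS r b|" for n
      by (rule ordIso_ordLeq_trans[OF a(2) card_of_mono1])
    then have "csup s \<le>o |underS r b|" by (rule csup_least[of s, OF s card_of_Card_order])
    with sup have "r \<le>o |underS r b|" by (rule ordLeq_transitive)
    then show False using not_ordLess_ordLeq[OF card_of_underS[OF Cr b(1)]] by blast
  qed
  obtain A where A: "A \<subseteq> Field r" "cofinal A r" "cf r = |A|"
    using is_cf_cf[OF r] unfolding is_cf_def by blast
  have "\<forall>B\<subseteq>Field r. cofinal B r \<longrightarrow> cf r \<le>o |B|"
    using is_cf_cf[OF r] unfolding is_cf_def by (rule conjunct2)
  moreover have "range a \<subseteq> Field r" using a(1) by blast
  ultimately have "cf r \<le>o |range a|" using cofin by blast
  then have "cf r \<le>o natLeq"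
    by (rule ordLeq_transitive[OF _ ordLeq_ordIso_trans[OF card_of_image card_of_nat]])
  moreover have "natLeq \<le>o cf r"
    using infinite_if_cofinal[OF r A(1,2)] infinite_iff_natLeq_ordLeq[of A] unfolding A(3) by blast
  ultimately show ?thesis using ordIso_iff_ordLeq by blast
qed

text \<open>
  For infinite \<open>t\<close>, the segments cover \<open>r\<close>, so \<open>r \<le> \<omega> \<cdot> t = t\<close>. A finite \<open>t\<close> cannot bound all the
  segments: if \<open>b\<close> cuts off a segment of size \<open>t\<close>, then some \<open>a n\<close> strictly above \<open>b\<close> cuts off
  a segment with more than \<open>t\<close> elements.
\<close>

lemma ordLeq_if_cofinal_underS_ordLeq:
  fixes r :: "'a rel" and t :: "'b rel"
  assumes r: "Cinfinite r" and a: "\<And>n. a n \<in> Field r" and cofin: "cofinal (range a) r"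
    and t: "Card_order t" and ub: "\<And>n::nat. |underS r (a n)| \<le>o t"
  shows "r \<le>o t"
proof (cases "finite (Field t)")
  case False
  have cover: "Field r \<subseteq> (\<Union>n. underS r (a n))"
    using cofin unfolding cofinal_def underS_def by auto
  have "|UNIV :: nat set| \<le>o t"
    using False by (intro ordLeq_ordIso_trans[OF _ card_of_Field_ordIso[OF t]])
      (simp add: infinite_iff_card_of_nat)
  then have "|\<Union>n. underS r (a n)| \<le>o t"
    using False t ub by (intro card_of_UNION_ordLeq_infinite_Field) auto
  then have "|Field r| \<le>o t" by (rule ordLeq_transitive[OF card_of_mono1[OF cover]])
  moreover have "r =o |Field r|" using r ordIso_symmetric[OF card_of_Field_ordIso] by blast
  ultimately show ?thesis using ordIso_ordLeq_trans by blast
next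
  case True
  have Cr: "Card_order r" and wo: "wo_rel r"
    using r by (simp_all add: wo_rel_def card_order_on_well_order_on)
  show ?thesis
  proof (rule ccontr)
    assume "\<not> r \<le>o t"
    then have "t <o r" using Card_order_not_ordLeq_iff[OF Cr t] by blast
    then obtain b where b: "b \<in> Field r" "t =o |underS r b|"
      using ordLess_ordIso_underS[OF t Cr] by blast
    obtain n where n: "b \<noteq> a n" "(b, a n) \<in> r"
      using cofin b(1) unfolding cofinal_def by blast
    have sub: "underS r b \<subset> underS r (a n)"
      using underS_incr[OF wo_rel.TRANS[OF wo] wo_rel.ANTISYM[OF wo] n(2)] n
      unfolding underS_def by blast
    have le: "|underS r (a n)| \<le>o |underS r b|"
      using ub b(2) by (rule ordLeq_ordIso_trans)
    have fin: "finite (underS r b)"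
      using True card_of_ordIso_finite_Field[OF t b(2)] by blast
    then have "finite (underS r (a n))" using le card_of_ordLeq_finite by blast
    then have "card (underS r b) < card (underS r (a n))" using sub by (rule psubset_card_mono)
    moreover obtain f where "inj_on f (underS r (a n))" "f ` underS r (a n) \<subseteq> underS r b"
      using le card_of_ordLeq[of "underS r (a n)" "underS r b"] by blast
    then have "card (underS r (a n)) \<le> card (underS r b)" using fin by (rule card_inj_on_le)
    ultimately show False by simp
  qed
qed

text \<open>
  The sequence consists of the sizes of the segments cut off by an enumerated cofinal set. Its
  members are copied to the type of \<open>c\<close>, because \<open>Min_card k c\<close> asks for a sequence there while
  \<open>r\<close> is to be \<open>clog k\<close>, which lives on the type of \<open>k\<close>.
\<close>

lemma csup_if_cf_natLeq:
  fixes r :: "'a rel" and c :: "'b rel"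
  assumes r: "Cinfinite r" and cf: "cf r =o natLeq" and c: "Card_order c" "c =o r"
  shows "\<exists>s :: nat \<Rightarrow> 'b rel. (\<forall>n. Card_order (s n) \<and> s n <o r) \<and> c =o csup s"
proof -
  have Cr: "Card_order r" using r by blast
  obtain A where A: "A \<subseteq> Field r" "cofinal A r" "cf r = |A|"
    using is_cf_cf[OF r] unfolding is_cf_def by blast
  have "|UNIV :: nat set| =o |A|"
    using card_of_nat ordIso_symmetric[OF cf] unfolding A(3) by (rule ordIso_transitive)
  then obtain a :: "nat \<Rightarrow> 'a" where "bij_betw a UNIV A" using card_of_ordIso by blast
  then have a: "A = range a" by (simp add: bij_betw_def)
  then have aF: "a n \<in> Field r" for n using A(1) by blast
  have less: "|underS r (a n)| <o r" for n using Cr aF by (rule card_of_underS)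
  then have "|underS r (a n)| \<le>o c" for n
    using ordLess_ordIso_trans[OF _ ordIso_symmetric[OF c(2)]] ordLess_imp_ordLeq by blast
  then have "\<exists>t :: 'b rel. Card_order t \<and> t =o |underS r (a n)|" for n
    using cardinal_transfer card_of_Card_order by blast
  then obtain s :: "nat \<Rightarrow> 'b rel"
    where s: "\<And>n. Card_order (s n)" "\<And>n. s n =o |underS r (a n)|"
    by metis
  have sl: "s n <o r" for n using s(2) less by (rule ordIso_ordLess_trans)
  have "|underS r (a n)| \<le>o csup s" for n
    using ordIso_symmetric[OF s(2)] csup_upper[of s, OF s(1)] by (rule ordIso_ordLeq_trans)
  then have "r \<le>o csup s"
    using ordLeq_if_cofinal_underS_ordLeq[of r a "csup s"] r aF A(2) Card_order_csup[of s, OF s(1)]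
    unfolding a by simp
  with c(2) have "c \<le>o csup s" by (rule ordIso_ordLeq_trans)
  moreover have "s n \<le>o c" for n
    using ordLess_ordIso_trans[OF sl ordIso_symmetric[OF c(2)]] by (rule ordLess_imp_ordLeq)
  then have "csup s \<le>o c" using csup_least[of s c] s(1) c(1) by simp
  ultimately have "c =o csup s" using ordIso_iff_ordLeq by blast
  then show ?thesis using s(1) sl by blast
qed

section \<open>Characterisation of Min\<close>

lemma Min_card_if_eq_ctwo_cexp:
  assumes "Card_order c" and eq: "k =o ctwo ^c c"
  shows "Min_card k c"
proof -
  have "csup (\<lambda>n :: nat. ctwo ^c c) =o ctwo ^c c"
    by (rule ordIso_symmetric[OF csup_const[OF Card_order_cexp]])
  then have "csup (\<lambda>n :: nat. ctwo ^c c) =o k"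
    using ordIso_symmetric[OF eq] by (rule ordIso_transitive)
  then show ?thesis
    unfolding Min_card_def using assms csup_const[OF assms(1)]
    by (intro exI[of _ "\<lambda>n. c"]) (simp add: ordIso_iff_ordLeq)
qed

lemma Min_card_iff_if_not_exponential:
  fixes k :: "'a rel" and c :: "'b rel"
  assumes k: "Card_order k" "\<not> exponential k" and c: "Cinfinite c"
  shows "Min_card k c \<longleftrightarrow> c =o clog k \<and> cf (clog k) =o natLeq"
proof
  assume "Min_card k c"
  then obtain s :: "nat \<Rightarrow> 'b rel" where s: "\<And>n. Card_order (s n)" and sup: "c =o csup s"
    and le: "csup (\<lambda>n. ctwo ^c s n) \<le>o k" and ge: "k \<le>o ctwo ^c c"
    unfolding Min_card_def by blast
  have less: "s n <o clog k" for n
  proof -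
    have "ctwo ^c s n \<le>o k"
      using csup_upper[of "\<lambda>n. ctwo ^c s n" n, OF Card_order_cexp] le by (rule ordLeq_transitive)
    moreover have "\<not> k =o ctwo ^c s n" using exponentialI[OF s] k(2) by blast
    ultimately have "ctwo ^c s n <o k"
      using ordLeq_iff_ordLess_or_ordIso ordIso_symmetric by blast
    then show ?thesis using ordLess_clog_iff[OF k(1) s] by blast
  qed
  have "csup s \<le>o clog k"
    using csup_least[of s "clog k", OF s Card_order_clog[OF k(1)]] less ordLess_imp_ordLeq by blast
  then have "c \<le>o clog k" using sup ordIso_ordLeq_trans by blast
  moreover have "clog k \<le>o c" using clog_ordLeq_iff[of k c] k(1) c ge by simp
  ultimately have eq: "c =o clog k" using ordIso_iff_ordLeq by blast
  have "Cinfinite (clog k)" using Cinfinite_cong[OF eq] c by blast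
  moreover have "clog k \<le>o csup s" using \<open>clog k \<le>o c\<close> sup ordLeq_ordIso_trans by blast
  ultimately have "cf (clog k) =o natLeq" using cf_natLeq_if_csup[of "clog k" s] s less by simp
  with eq show "c =o clog k \<and> cf (clog k) =o natLeq" by blast
next
  assume rhs: "c =o clog k \<and> cf (clog k) =o natLeq"
  have "Cinfinite (clog k)" using Cinfinite_cong[OF conjunct1[OF rhs] c] .
  then obtain s :: "nat \<Rightarrow> 'b rel"
    where s: "\<And>n. Card_order (s n)" "\<And>n. s n <o clog k" "c =o csup s"
    using csup_if_cf_natLeq[of "clog k" c] rhs c by blast
  have "ctwo ^c s n \<le>o k" for n
    using ordLess_clog_iff[OF k(1) s(1)] s(2) ordLess_imp_ordLeq by blast
  then have "csup (\<lambda>n. ctwo ^c s n) \<le>o k"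
    by (rule csup_least[of "\<lambda>n. ctwo ^c s n" k, OF Card_order_cexp k(1)])
  moreover have "k \<le>o ctwo ^c c"
    using clog_ordLeq_iff[of k c] k(1) c rhs by (simp add: ordIso_iff_ordLeq)
  ultimately show "Min_card k c" unfolding Min_card_def using s(1,3) by (intro exI[of _ s]) simp
qed

theorem proposition3p5:
  fixes \<kappa> :: "'a rel"
  assumes "Cinfinite \<kappa>"
  shows "(exponential \<kappa> \<longrightarrow>
            (\<forall>\<sigma> :: 'b rel. Card_order \<sigma> \<and> \<kappa> =o ctwo ^c \<sigma> \<longrightarrow> Min_card \<kappa> \<sigma>)) \<and>
         (\<not> exponential \<kappa> \<longrightarrow>
            (\<forall>\<sigma> :: 'b rel. Cinfinite \<sigma> \<longrightarrow>
               (Min_card \<kappa> \<sigma> \<longleftrightarrow> \<sigma> =o clog \<kappa> \<and> cf (clog \<kappa>) =o natLeq)))"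
proof (intro conjI impI allI)
  fix \<sigma> :: "'b rel"
  assume "Card_order \<sigma> \<and> \<kappa> =o ctwo ^c \<sigma>"
  then show "Min_card \<kappa> \<sigma>" using Min_card_if_eq_ctwo_cexp[of \<sigma> \<kappa>] by simp
next
  fix \<sigma> :: "'b rel"
  assume "\<not> exponential \<kappa>" "Cinfinite \<sigma>"
  then show "Min_card \<kappa> \<sigma> \<longleftrightarrow> \<sigma> =o clog \<kappa> \<and> cf (clog \<kappa>) =o natLeq"
    by (rule Min_card_iff_if_not_exponential[OF conjunct2[OF assms]])
qed

end
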